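(* Let $L,V,\mu,T>0$, let $0=t_0<t_1<\dots<t_N=T$ be a uniform grid with step $h$, and let $\Delta=\lceil \frac{L}{Vh}\rceil$. Let $Q_0,\dots,Q_N$ be the given discrete values of the cumulative inflow profile, and let the initial data be $q(0)=q_0>0$ and $\rho_0(x)\equiv 0$. Define $\hat Q_0=0$ and $\hat Q_i=Q_i+q_0$ for $1\le i\le N$. Let $U(t,L)$ be the (continuous-time) exit flow profile associated with the piecewise affine interpolant of the points $(t_i,Q_i)$ and the initial data $q(0)=q_0$, $\rho_0(x)\equiv 0$, as defined in the context. Define $$U_{i,L}=\begin{cases}0, & 0\le i<\Delta,\\ \displaystyle\min_{0\le j\le i-\Delta}\{\hat Q_j-\mu t_j\}+(t_i-L/V)\mu, & \Delta\le i\le N.\end{cases}$$ Then $$0\le U_{i,L}\le U_{i+1,L},\qquad \Delta\le i\le N-1,$$ and $$0\le U_{i,L}-U(t_i,L)\le\Big(\Big\lceil\frac{L}{Vh}\Big\rceil-\frac{L}{Vh}\Big)h\mu,\qquad \Delta\le i\le N.$$ In particular, if $\frac{L}{Vh}$ is an integer, the discrete formula is exact, i.e. $U_{i,L}=U(t_i,L)$.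
   Context: A processor has length $L$, processing speed $V$ and flow capacity $\mu$, and is preceded by a buffer queue with initial size $q_0$; $\rho_0$ is the initial density of products on the processor. The cumulative arrival function at the queue, $Q:(-\infty,T]\to[0,\infty)$, is non-decreasing and left-continuous with $Q(t)=0$ for $t<0$; the discrete values are $Q_i=Q(t_i-)$, so $0=Q_0\le Q_1\le\dots\le Q_N$. $Q$ is then approximated by (and below denotes) the piecewise affine interpolant on $[0,T]$ with break points $(t_i,Q_i)$, $0\le i\le N$. Set $\hat Q(t)=0$ for $t\le 0$ and $\hat Q(t)=q_0+Q(t)$ for $0<t\le T$. The continuous-time exit profile (cumulative number of products that have left the processor by time $t$), with $\rho_0\equiv0$, is $$U(t,L)=\begin{cases}0, & t\in[0,L/V),\\ \displaystyle\min_{\tau\in\Omega_t}\{\hat Q(\tau)-\mu\tau\}+(t-L/V)\mu, & t\in[L/V,T],\end{cases}$$ where $\Omega_t=\{t_i:\ t_i\le t-L/V\}\cup\{t-L/V\}$. *)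

theory Defs
  imports Complex_Main
begin

text \<open>Functions on \<open>(-\<infinity>,T]\<close> or \<open>[0,T]\<close> are total functions on the reals; their values beyond \<open>T\<close>
  are irrelevant.\<close>

definition cumulative_arrival :: "real \<Rightarrow> (real \<Rightarrow> real) \<Rightarrow> bool" where
  "cumulative_arrival T A \<longleftrightarrow>
     mono_on {..T} A \<and>
     (\<forall>s\<le>T. 0 \<le> A s) \<and>
     (\<forall>s\<le>T. continuous (at_left s) A) \<and>
     (\<forall>s<0. A s = 0)"

definition uniform_grid :: "nat \<Rightarrow> real \<Rightarrow> real \<Rightarrow> (nat \<Rightarrow> real) \<Rightarrow> bool" where
  "uniform_grid N T h t \<longleftrightarrow>
     t 0 = 0 \<and> t N = T \<and> (\<forall>i<N. t i < t (Suc i) \<and> t (Suc i) - t i = h)"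

text \<open>The interval used for \<open>s\<close> is the last one starting at or before \<open>s\<close>; for \<open>s = t N\<close> it is the
  final one, because of \<open>i < N\<close>. Only meaningful for \<open>t 0 \<le> s \<le> t N\<close>.\<close>

definition affine_interpolant ::
    "nat \<Rightarrow> (nat \<Rightarrow> real) \<Rightarrow> (nat \<Rightarrow> real) \<Rightarrow> real \<Rightarrow> real" where
  "affine_interpolant N t y s =
     (let i = Max {i. i < N \<and> t i \<le> s}
      in y i + (s - t i) / (t (Suc i) - t i) * (y (Suc i) - y i))"

lemma affine_interpolant_eq:
  assumes mono: "\<And>i. i < N \<Longrightarrow> t i < t (Suc i)"
    and i: "i < N" and s: "t i \<le> s" "s \<le> t (Suc i)"
  shows "affine_interpolant N t y s = y i + (s - t i) / (t (Suc i) - t i) * (y (Suc i) - y i)"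
proof -
  have lt: "t j < t k" if "j < k" "k \<le> N" for j k
    using that
  proof (induction k)
    case (Suc k)
    then show ?case using mono[of k] by (cases "j = k") auto
  qed simp
  define m where "m = Max {j. j < N \<and> t j \<le> s}"
  have fin: "finite {j. j < N \<and> t j \<le> s}" by simp
  have "m \<in> {j. j < N \<and> t j \<le> s}"
    unfolding m_def using fin i s by (intro Max_in) auto
  then have m: "m < N" "t m \<le> s" by auto
  have "i \<le> m"
    unfolding m_def using fin i s by (intro Max_ge) auto
  have eq: "affine_interpolant N t y s = y m + (s - t m) / (t (Suc m) - t m) * (y (Suc m) - y m)"
    unfolding affine_interpolant_def m_def Let_def ..
  show ?thesis
  proof (cases "m = i")
    case True
    then show ?thesis using eq by simp
  next
    case False
    with \<open>i \<le> m\<close> have "Suc i \<le> m" by simp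
    moreover have "\<not> Suc i < m" using lt[of "Suc i" m] m s by auto
    ultimately have mi: "m = Suc i" by simp
    then have "s = t (Suc i)" using m s by simp
    then show ?thesis
      using eq mono[OF i] mi by simp
  qed
qed

text \<open>The initial queue \<open>q\<^sub>0\<close> enters as a jump of the inflow profile at time 0.\<close>

definition Q_hat :: "real \<Rightarrow> (real \<Rightarrow> real) \<Rightarrow> real \<Rightarrow> real" where
  "Q_hat q\<^sub>0 Q s = (if s \<le> 0 then 0 else q\<^sub>0 + Q s)"

definition Q_hat_discrete :: "real \<Rightarrow> (nat \<Rightarrow> real) \<Rightarrow> nat \<Rightarrow> real" where
  "Q_hat_discrete q\<^sub>0 Q i = (if i = 0 then 0 else Q i + q\<^sub>0)"

definition exit_times :: "real \<Rightarrow> real \<Rightarrow> nat \<Rightarrow> (nat \<Rightarrow> real) \<Rightarrow> real \<Rightarrow> real set" where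
  "exit_times L V N t s = {t i | i. i \<le> N \<and> t i \<le> s - L / V} \<union> {s - L / V}"

text \<open>The profile at time \<open>s\<close> for an initially empty processor (\<open>\<rho>\<^sub>0 \<equiv> 0\<close>), where \<open>Q\<close> is the
  continuous-time inflow.\<close>

definition exit_profile ::
    "real \<Rightarrow> real \<Rightarrow> real \<Rightarrow> real \<Rightarrow> nat \<Rightarrow> (nat \<Rightarrow> real) \<Rightarrow> (real \<Rightarrow> real) \<Rightarrow> real \<Rightarrow> real" where
  "exit_profile L V \<mu> q\<^sub>0 N t Q s =
     (if s < L / V then 0
      else Min ((\<lambda>\<tau>. Q_hat q\<^sub>0 Q \<tau> - \<mu> * \<tau>) ` exit_times L V N t s) + (s - L / V) * \<mu>)"

text \<open>The delay \<open>\<Delta>\<close>, counted in grid steps.\<close>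

definition delay_steps :: "real \<Rightarrow> real \<Rightarrow> real \<Rightarrow> nat" where
  "delay_steps L V h = nat \<lceil>L / (V * h)\<rceil>"

definition exit_profile_discrete ::
    "real \<Rightarrow> real \<Rightarrow> real \<Rightarrow> real \<Rightarrow> real \<Rightarrow> (nat \<Rightarrow> real) \<Rightarrow> (nat \<Rightarrow> real) \<Rightarrow> nat \<Rightarrow> real" where
  "exit_profile_discrete L V \<mu> q\<^sub>0 h t Q i =
     (if i < delay_steps L V h then 0
      else Min ((\<lambda>j. Q_hat_discrete q\<^sub>0 Q j - \<mu> * t j) ` {0..i - delay_steps L V h})
             + (t i - L / V) * \<mu>)"

end

theory Submission imports Defs begin

text \<open>Put \<open>\<delta> = \<Delta>h - L/V \<in> [0,h)\<close>. Then \<open>t\<^sub>i - L/V = t\<^sub>k + \<delta>\<close> with \<open>k = i - \<Delta>\<close>, so the continuous minimum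
  runs over the same grid points \<open>t\<^sub>0,\<dots>,t\<^sub>k\<close> as the discrete one and over the single extra point
  \<open>t\<^sub>k + \<delta>\<close>. As the inflow is non-decreasing, the value at the extra point is smaller than the value at
  \<open>t\<^sub>k\<close> by at most \<open>\<mu>\<delta>\<close>.\<close>

lemma uniform_grid_eq:
  assumes "uniform_grid N T h t" "i \<le> N"
  shows "t i = real i * h"
  using assms(2)
proof (induction i)
  case 0
  then show ?case using assms(1) by (simp add: uniform_grid_def)
next
  case (Suc i)
  have "t (Suc i) - t i = h" using assms(1) Suc.prems by (simp add: uniform_grid_def)
  moreover have "t i = real i * h" using Suc by simp
  ultimately show ?case by (simp add: algebra_simps)
qed

lemma uniform_grid_step_pos:
  assumes "uniform_grid N T h t" "T > 0"
  shows "N > 0" "h > 0"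
proof -
  show "N > 0" using assms by (cases "N = 0") (auto simp: uniform_grid_def)
  then have "t 0 < t (Suc 0)" "t (Suc 0) - t 0 = h"
    using assms(1) by (auto simp: uniform_grid_def)
  then show "h > 0" by simp
qed

text \<open>Holds because left limits on the reals are unique. The grid values \<open>Q i\<close>
  are given as left limits of \<open>A\<close>; this makes them values of \<open>A\<close>, so that
  they inherit its sign and monotonicity.\<close>

lemma cumulative_arrival_left_limit:
  assumes "cumulative_arrival T A" "s \<le> T" "(A \<longlongrightarrow> l) (at_left s)"
  shows "l = A s"
proof -
  have "(A \<longlongrightarrow> A s) (at_left s)"
    using assms(1,2) by (simp add: cumulative_arrival_def continuous_within)
  with assms(3) show ?thesis
    using tendsto_unique trivial_limit_at_left_real by blast
qed

text \<open>Evaluates at the right end of the interval before \<open>t j\<close>, which covers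
  \<open>j = N\<close> too. No such interval exists for \<open>j = 0\<close>, but
  \<open>Q_hat\<close> is 0 at time 0 whatever the interpolant gives there.\<close>

lemma affine_interpolant_grid:
  assumes mono: "\<And>i. i < N \<Longrightarrow> t i < t (Suc i)" and "0 < j" "j \<le> N"
  shows "affine_interpolant N t y (t j) = y j"
proof -
  obtain i where j: "j = Suc i" using \<open>0 < j\<close> by (cases j) auto
  then have "t i < t j" using assms by auto
  then show ?thesis
    using affine_interpolant_eq[of N t i "t j" y, OF mono] j assms(3) by simp
qed

lemma affine_interpolant_ge:
  assumes mono: "\<And>i. i < N \<Longrightarrow> t i < t (Suc i)"
    and "k < N" "t k \<le> s" "s \<le> t (Suc k)" "y k \<le> y (Suc k)"
  shows "y k \<le> affine_interpolant N t y s"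
  using affine_interpolant_eq[of N t k s y, OF mono] assms mono[of k]
  by simp

lemma Q_hat_discrete_nonneg:
  assumes "q\<^sub>0 \<ge> 0" "Q i \<ge> 0"
  shows "Q_hat_discrete q\<^sub>0 Q i \<ge> 0"
  using assms by (simp add: Q_hat_discrete_def)

text \<open>Index 0 breaks the pattern with the value 0; \<open>0 \<le> Q j\<close> keeps every
  later value above it.\<close>

lemma Q_hat_discrete_mono:
  assumes "q\<^sub>0 \<ge> 0" "i \<le> j" "0 \<le> Q j" "Q i \<le> Q j"
  shows "Q_hat_discrete q\<^sub>0 Q i \<le> Q_hat_discrete q\<^sub>0 Q j"
  using assms by (auto simp: Q_hat_discrete_def)

theorem proposition3p5:
  fixes L V \<mu> T h q\<^sub>0 :: real and N \<Delta> :: nat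
    and t Q :: "nat \<Rightarrow> real" and A U :: "real \<Rightarrow> real" and UL :: "nat \<Rightarrow> real"
  assumes pos: "L > 0" "V > 0" "\<mu> > 0" "T > 0"
    and grid: "uniform_grid N T h t"
    and Delta: "\<Delta> = delay_steps L V h"
    and arrival: "cumulative_arrival T A"
    and Q: "\<And>i. i \<le> N \<Longrightarrow> (A \<longlongrightarrow> Q i) (at_left (t i))"
    and q0: "q\<^sub>0 > 0"
    and U: "U = exit_profile L V \<mu> q\<^sub>0 N t (affine_interpolant N t Q)"
    and UL: "UL = exit_profile_discrete L V \<mu> q\<^sub>0 h t Q"
  shows "(\<forall>i. \<Delta> \<le> i \<and> i < N \<longrightarrow> 0 \<le> UL i \<and> UL i \<le> UL (i + 1)) \<and>
         (\<forall>i. \<Delta> \<le> i \<and> i \<le> N \<longrightarrow>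
            0 \<le> UL i - U (t i) \<and>
            UL i - U (t i) \<le> (real_of_int \<lceil>L / (V * h)\<rceil> - L / (V * h)) * h * \<mu>) \<and>
         (L / (V * h) \<in> \<int> \<longrightarrow> (\<forall>i\<le>N. UL i = U (t i)))"
proof -
  define c where "c = L / V"
  \<comment> \<open>The amount by which the delay is rounded up, written so that the claimed error
    bound is \<open>\<delta> * \<mu>\<close>.\<close>
  define \<delta> where "\<delta> = (real_of_int \<lceil>L / (V * h)\<rceil> - L / (V * h)) * h"
  define P where "P j = Q_hat_discrete q\<^sub>0 Q j - \<mu> * t j" for j
  define R where "R \<tau> = Q_hat q\<^sub>0 (affine_interpolant N t Q) \<tau> - \<mu> * \<tau>" for \<tau>
  have h: "h > 0" using uniform_grid_step_pos(2)[OF grid] pos by simp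
  have x0: "L / (V * h) > 0" using pos h by simp
  \<comment> \<open>Positivity of the ceiling makes the conversion by \<open>nat\<close> harmless.
    \<open>\<Delta> \<ge> 1\<close> gives \<open>i - \<Delta> < N\<close>, so a grid interval starts
    at \<open>t (i - \<Delta>)\<close> and can hold the extra point.\<close>
  have D1: "\<Delta> \<ge> 1" and realD: "real \<Delta> = real_of_int \<lceil>L / (V * h)\<rceil>"
    using x0 unfolding Delta delay_steps_def by linarith+
  have xh: "L / (V * h) * h = c" using h unfolding c_def by simp
  then have deltaD: "\<delta> = real \<Delta> * h - c"
    unfolding \<delta>_def realD by (simp add: left_diff_distrib)
  have d0: "0 \<le> \<delta>" using h unfolding \<delta>_def by simp
  have "real_of_int \<lceil>L / (V * h)\<rceil> - L / (V * h) < 1" by linarith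
  then have dh: "\<delta> < h" using h unfolding \<delta>_def by simp

  have t: "t i = real i * h" if "i \<le> N" for i using uniform_grid_eq[OF grid that] .
  have tN: "t N = T" using grid by (simp add: uniform_grid_def)
  have incr: "t i < t (Suc i)" if "i < N" for i using grid that by (simp add: uniform_grid_def)
  have tT: "t i \<le> T" if "i \<le> N" for i
    using t[OF that] t[of N] tN that h by (simp add: mult_right_mono)
  have QA: "Q i = A (t i)" if "i \<le> N" for i
    using cumulative_arrival_left_limit[OF arrival tT[OF that] Q[OF that]] .
  have Q0: "0 \<le> Q i" if "i \<le> N" for i
    using QA[OF that] tT[OF that] arrival by (simp add: cumulative_arrival_def)
  have Qmono: "Q i \<le> Q j" if "i \<le> j" "j \<le> N" for i j
  proof -
    have "t i \<le> t j" using that t[of i] t[of j] h by (simp add: mult_right_mono)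
    then show ?thesis
      using QA[of i] QA[of j] tT[of i] tT[of j] that arrival
      by (auto simp: cumulative_arrival_def intro: mono_onD)
  qed
  have QD0: "0 \<le> Q_hat_discrete q\<^sub>0 Q j" if "j \<le> N" for j
    using Q_hat_discrete_nonneg q0 Q0[OF that] by simp
  have QDm: "Q_hat_discrete q\<^sub>0 Q i \<le> Q_hat_discrete q\<^sub>0 Q j" if "i \<le> j" "j \<le> N" for i j
    using Q_hat_discrete_mono q0 Q0[of j] Qmono[of i j] that by simp

  \<comment> \<open>At \<open>j = 0\<close> both sides use the value 0 before the jump by
    \<open>q\<^sub>0\<close>; for \<open>j > 0\<close> both include the jump.\<close>
  have R_grid: "R (t j) = P j" if "j \<le> N" for j
  proof (cases "j = 0")
    case True
    then show ?thesis using t[of 0] by (simp add: R_def P_def Q_hat_def Q_hat_discrete_def)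
  next
    case False
    then have "t j > 0" using t[OF that] h by simp
    then show ?thesis
      using affine_interpolant_grid[of N t j Q, OF incr] False that
      by (simp add: R_def P_def Q_hat_def Q_hat_discrete_def)
  qed
  have R_extra: "P k - \<mu> * \<delta> \<le> R (t k + \<delta>)" if "k < N" for k
  proof -
    have "t k + \<delta> \<le> t (Suc k)" using t[of k] t[of "Suc k"] that dh by (simp add: algebra_simps)
    then have "Q k \<le> affine_interpolant N t Q (t k + \<delta>)"
      using affine_interpolant_ge[of N t k "t k + \<delta>" Q, OF incr] Qmono[of k "Suc k"] that d0
      by simp
    moreover have "0 \<le> Q k" using Q0 that by simp
    \<comment> \<open>Separates the case \<open>k = 0\<close>, where the discrete value is 0 while
      \<open>Q_hat\<close> at \<delta> is 0 or, past the jump, at least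
      \<open>q\<^sub>0\<close>.\<close>
    moreover have "k = 0 \<longleftrightarrow> t k \<le> 0" using t[of k] that h by (auto simp: mult_le_0_iff)
    ultimately have "Q_hat_discrete q\<^sub>0 Q k \<le> Q_hat q\<^sub>0 (affine_interpolant N t Q) (t k + \<delta>)"
      using q0 d0 by (auto simp: Q_hat_def Q_hat_discrete_def)
    then show ?thesis by (simp add: P_def R_def algebra_simps)
  qed

  have shift: "t i - c = t (i - \<Delta>) + \<delta>" if "\<Delta> \<le> i" "i \<le> N" for i
  proof -
    have "t (i - \<Delta>) = real (i - \<Delta>) * h" using t that by simp
    then show ?thesis using t[of i] that deltaD by (simp add: of_nat_diff algebra_simps)
  qed
  have UL_eq: "UL i = Min (P ` {0..i - \<Delta>}) + (t (i - \<Delta>) + \<delta>) * \<mu>" if "\<Delta> \<le> i" "i \<le> N" for i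
    using that shift[OF that] unfolding UL exit_profile_discrete_def Delta[symmetric] P_def c_def
    by simp
  have times: "exit_times L V N t (t i) = t ` {0..i - \<Delta>} \<union> {t (i - \<Delta>) + \<delta>}"
    if "\<Delta> \<le> i" "i \<le> N" for i
  proof -
    have "t j \<le> t (i - \<Delta>) + \<delta> \<longleftrightarrow> j \<le> i - \<Delta>" if "j \<le> N" for j
    proof
      assume "j \<le> i - \<Delta>"
      then have "t j \<le> t (i - \<Delta>)"
        using t[of j] t[of "i - \<Delta>"] \<open>i \<le> N\<close> that h by (simp add: mult_right_mono)
      then show "t j \<le> t (i - \<Delta>) + \<delta>" using d0 by simp
    next
      assume "t j \<le> t (i - \<Delta>) + \<delta>"
      then have "real j * h < (real (i - \<Delta>) + 1) * h"
        using t[of j] t[of "i - \<Delta>"] \<open>i \<le> N\<close> that dh by (simp add: algebra_simps)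
      then show "j \<le> i - \<Delta>" using h by simp
    qed
    then show ?thesis
      using shift[OF that] that unfolding exit_times_def c_def by auto
  qed
  have U_eq: "U (t i) = min (Min (P ` {0..i - \<Delta>})) (R (t (i - \<Delta>) + \<delta>)) + (t (i - \<Delta>) + \<delta>) * \<mu>"
    if "\<Delta> \<le> i" "i \<le> N" for i
  proof -
    have "0 \<le> t (i - \<Delta>)" using t[of "i - \<Delta>"] that h by simp
    then have "\<not> t i < L / V" using shift[OF that] d0 unfolding c_def by simp
    moreover have "R ` exit_times L V N t (t i) = insert (R (t (i - \<Delta>) + \<delta>)) (P ` {0..i - \<Delta>})"
      using R_grid that unfolding times[OF that] by (auto simp: image_image)
    ultimately show ?thesis
      using shift[OF that] unfolding U exit_profile_def c_def R_def
      by (simp add: min.commute)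
  qed

  have nonneg: "0 \<le> UL i" if "\<Delta> \<le> i" "i \<le> N" for i
  proof -
    \<comment> \<open>Every candidate of the minimum has a nonnegative inflow and a time at most
      \<open>t i - c\<close>, so the linear term of \<open>UL i\<close> compensates its negative
      part.\<close>
    have "- ((t (i - \<Delta>) + \<delta>) * \<mu>) \<le> P j" if "j \<le> i - \<Delta>" for j
    proof -
      have "t j \<le> t (i - \<Delta>) + \<delta>"
        using t[of j] t[of "i - \<Delta>"] \<open>i \<le> N\<close> that h d0
        by (simp add: mult_right_mono add_increasing2)
      then have "t j * \<mu> \<le> (t (i - \<Delta>) + \<delta>) * \<mu>" using pos by simp
      moreover have "0 \<le> Q_hat_discrete q\<^sub>0 Q j" using QD0 that \<open>i \<le> N\<close> by simp
      ultimately show ?thesis by (simp add: P_def algebra_simps)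
    qed
    then have "- ((t (i - \<Delta>) + \<delta>) * \<mu>) \<le> Min (P ` {0..i - \<Delta>})" by (subst Min_ge_iff) auto
    then show ?thesis unfolding UL_eq[OF that] by linarith
  qed
  have step: "UL i \<le> UL (i + 1)" if "\<Delta> \<le> i" "i < N" for i
  proof -
    define k where "k = i - \<Delta>"
    have k: "i + 1 - \<Delta> = Suc k" "Suc k \<le> N" using that by (auto simp: k_def)
    have tk: "t (Suc k) = t k + h" using t[of k] t[of "Suc k"] k by (simp add: algebra_simps)
    have Min_le_P: "Min (P ` {0..k}) \<le> P j" if "j \<le> k" for j using that by (intro Min_le) auto
    \<comment> \<open>From \<open>i\<close> to \<open>i + 1\<close> the linear term gains
      \<open>h * \<mu>\<close> and the minimum gets the one new candidate \<open>P (Suc k)\<close>.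
      As the inflow does not decrease, that candidate lowers the minimum by at most
      \<open>h * \<mu>\<close>.\<close>
    have "P k - h * \<mu> \<le> P (Suc k)"
      using QDm[of k "Suc k"] k tk by (simp add: P_def algebra_simps)
    then have "Min (P ` {0..k}) - h * \<mu> \<le> P (Suc k)" using Min_le_P[of k] by linarith
    moreover have "Min (P ` {0..k}) - h * \<mu> \<le> P j" if "j \<le> k" for j
      using Min_le_P[OF that] mult_pos_pos[OF h \<open>\<mu> > 0\<close>] by linarith
    ultimately have "Min (P ` {0..k}) - h * \<mu> \<le> Min (P ` {0..Suc k})"
      by (subst Min_ge_iff) (auto simp: le_Suc_eq)
    moreover have "UL i = Min (P ` {0..k}) + (t k + \<delta>) * \<mu>"
      using UL_eq[of i] that by (simp add: k_def)
    moreover have "UL (i + 1) = Min (P ` {0..Suc k}) + (t k + h + \<delta>) * \<mu>"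
      using UL_eq[of "i + 1"] that k(1) tk by simp
    ultimately show ?thesis by (simp add: algebra_simps)
  qed
  have error: "0 \<le> UL i - U (t i) \<and> UL i - U (t i) \<le> \<delta> * \<mu>" if "\<Delta> \<le> i" "i \<le> N" for i
  proof -
    have "Min (P ` {0..i - \<Delta>}) \<le> P (i - \<Delta>)" by (intro Min_le) auto
    moreover have "P (i - \<Delta>) - \<mu> * \<delta> \<le> R (t (i - \<Delta>) + \<delta>)" using R_extra that D1 by simp
    moreover have "0 \<le> \<mu> * \<delta>" using pos d0 by simp
    \<comment> \<open>The linear terms cancel, leaving the difference between a minimum and the same
      minimum with one more candidate.\<close>
    ultimately show ?thesis
      unfolding UL_eq[OF that] U_eq[OF that] mult.commute[of \<delta> \<mu>] by linarith
  qed
  have exact: "UL i = U (t i)" if int: "L / (V * h) \<in> \<int>" and i: "i \<le> N" for i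
  proof -
    have "\<delta> = 0" using int by (auto simp: \<delta>_def elim!: Ints_cases)
    show ?thesis
    proof (cases "\<Delta> \<le> i")
      case True
      then show ?thesis using error[OF True i] \<open>\<delta> = 0\<close> by simp
    next
      case False
      \<comment> \<open>The error bound does not reach these indices. With \<delta> = 0 the delay is
        exactly \<open>\<Delta> * h\<close>, so both profiles are still in their zero
        branch.\<close>
      then have "real i * h < real \<Delta> * h" using h by simp
      then have "t i < L / V" using t[OF i] deltaD \<open>\<delta> = 0\<close> c_def by simp
      then show ?thesis
        using False by (simp add: U UL exit_profile_def exit_profile_discrete_def Delta[symmetric])
    qed
  qed
  show ?thesis using nonneg step error exact unfolding \<delta>_def by simp
qed

end
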